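(* Let $\mathcal{G}$ be the family of graphs $H$ satisfying $|\mathrm{corona}(H)|+|\mathrm{core}(H)|=2\alpha(H)+1$. Then for every graph $G$, $G\in\mathcal{G}$ if and only if $L_G^c\in\mathcal{G}$, where $L_G^c=G[V(G)\setminus L(G)]$ is the subgraph of $G$ induced by the complement of Larson's set $L(G)$.
   Context: All graphs are finite, undirected and simple; the graph with no vertices is allowed as an induced subgraph (its only independent set is $\emptyset$). $\alpha(G)$ is the maximum cardinality of an independent set of $G$, $\mu(G)$ the maximum cardinality of a matching, and $n(G)=|V(G)|$. $\Omega(G)$ is the set of maximum (i.e. maximum-cardinality) independent sets of $G$; $\mathrm{core}(G)=\bigcap_{S\in\Omega(G)}S$ and $\mathrm{corona}(G)=\bigcup_{S\in\Omega(G)}S$. For $X\subseteq V(G)$, $N(X)=\bigcup_{v\in X}N(v)$ is its neighborhood and $d_G(X)=|X|-|N(X)|$. An independent set $X$ (possibly empty) is a critical independent set if $d_G(X)$ is maximum over all independent sets of $G$ (this maximum equals $\max_{X\subseteq V(G)}d_G(X)$); a maximum critical independent set is a critical independent set of maximum cardinality. A K\H{o}nig--Egerv\'ary graph is a graph with $\alpha(G)+\mu(G)=n(G)$. Larson's decomposition (known theorem defining $L(G)$): for any graph $G$ there is a unique set $L(G)\subseteq V(G)$ such that (1) $\alpha(G)=\alpha(G[L(G)])+\alpha(G[V(G)\setminus L(G)])$; (2) $G[L(G)]$ is a K\H{o}nig--Egerv\'ary graph; (3) for every non-empty independent set $I$ in the graph $G[V(G)\setminus L(G)]$, $|N(I)|>|I|$,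 with the neighborhood taken in $G[V(G)\setminus L(G)]$; (4) for every maximum critical independent set $J$ of $G$, $L(G)=J\cup N(J)$. Write $L^c(G)=V(G)\setminus L(G)$, $L_G=G[L(G)]$, $L_G^c=G[L^c(G)]$. *)

theory Defs
  imports "Graph_Theory.Digraph_Component"
begin

text \<open>
  The locale \<^locale>\<open>graph\<close> models a finite simple undirected graph as a finite, loop-free,
  symmetric digraph without parallel arcs; the null graph is included. An undirected edge is
  therefore a pair of opposite arcs, and \<open>u \<rightarrow>\<^bsub>G\<^esub> v\<close> is the adjacency relation.
  The induced subgraph \<open>G[W]\<close> is \<open>G \<restriction> W\<close>.
\<close>

definition edges :: "('a, 'b) pre_digraph \<Rightarrow> 'a set set" where
  "edges G = {{u, v} | u v. u \<rightarrow>\<^bsub>G\<^esub> v}"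

definition matching :: "('a, 'b) pre_digraph \<Rightarrow> 'a set set \<Rightarrow> bool" where
  "matching G M \<longleftrightarrow> M \<subseteq> edges G \<and> pairwise disjnt M"

definition matching_number :: "('a, 'b) pre_digraph \<Rightarrow> nat" where
  "matching_number G = Max (card ` {M. matching G M})"

definition independent :: "('a, 'b) pre_digraph \<Rightarrow> 'a set \<Rightarrow> bool" where
  "independent G S \<longleftrightarrow> S \<subseteq> verts G \<and> (\<forall>u\<in>S. \<forall>v\<in>S. \<not> u \<rightarrow>\<^bsub>G\<^esub> v)"

definition independence_number :: "('a, 'b) pre_digraph \<Rightarrow> nat" where
  "independence_number G = Max (card ` {S. independent G S})"

definition max_independent_sets :: "('a, 'b) pre_digraph \<Rightarrow> 'a set set" where
  "max_independent_sets G = {S. independent G S \<and> card S = independence_number G}"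

definition core :: "('a, 'b) pre_digraph \<Rightarrow> 'a set" where
  "core G = \<Inter>(max_independent_sets G)"

definition corona :: "('a, 'b) pre_digraph \<Rightarrow> 'a set" where
  "corona G = \<Union>(max_independent_sets G)"

definition neighborhood :: "('a, 'b) pre_digraph \<Rightarrow> 'a set \<Rightarrow> 'a set" where
  "neighborhood G X = (\<Union>u\<in>X. {v. u \<rightarrow>\<^bsub>G\<^esub> v})"

definition nbhd_difference :: "('a, 'b) pre_digraph \<Rightarrow> 'a set \<Rightarrow> int" where
  "nbhd_difference G X = int (card X) - int (card (neighborhood G X))"

definition critical_independent :: "('a, 'b) pre_digraph \<Rightarrow> 'a set \<Rightarrow> bool" where
  "critical_independent G X \<longleftrightarrow> independent G X \<and>
     (\<forall>Y. independent G Y \<longrightarrow> nbhd_difference G Y \<le> nbhd_difference G X)"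

definition max_critical_independent :: "('a, 'b) pre_digraph \<Rightarrow> 'a set \<Rightarrow> bool" where
  "max_critical_independent G J \<longleftrightarrow> critical_independent G J \<and>
     (\<forall>X. critical_independent G X \<longrightarrow> card X \<le> card J)"

definition koenig_egervary :: "('a, 'b) pre_digraph \<Rightarrow> bool" where
  "koenig_egervary G \<longleftrightarrow> independence_number G + matching_number G = card (verts G)"

definition is_larson_set :: "('a, 'b) pre_digraph \<Rightarrow> 'a set \<Rightarrow> bool" where
  "is_larson_set G L \<longleftrightarrow>
     L \<subseteq> verts G \<and>
     independence_number G =
       independence_number (G \<restriction> L) + independence_number (G \<restriction> (verts G - L)) \<and>
     koenig_egervary (G \<restriction> L) \<and>
     (\<forall>I. I \<noteq> {} \<and> independent (G \<restriction> (verts G - L)) I \<longrightarrow>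
        card (neighborhood (G \<restriction> (verts G - L)) I) > card I) \<and>
     (\<forall>J. max_critical_independent G J \<longrightarrow> L = J \<union> neighborhood G J)"

text \<open>
  Existence and uniqueness of the set described below, for every finite simple graph, is
  Larson's independence decomposition theorem.
\<close>

definition larson_set :: "('a, 'b) pre_digraph \<Rightarrow> 'a set" where
  "larson_set G = (THE L. is_larson_set G L)"

definition larson_complement :: "('a, 'b) pre_digraph \<Rightarrow> ('a, 'b) pre_digraph" where
  "larson_complement G = G \<restriction> (verts G - larson_set G)"

definition corona_core_family :: "('a, 'b) pre_digraph set" where
  "corona_core_family =
     {H. graph H \<and> card (corona H) + card (core H) = 2 * independence_number H + 1}"

end

theory Submission
  imports Defs
begin

text \<open>
  Fix a maximum critical independent set \<open>J\<close>, put \<open>L = J \<union> N(J)\<close>, and let \<open>S\<close> range over the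
  maximum independent sets of \<open>G\<close>. Everything rests on one matching: because \<open>d(J)\<close> is maximal,
  Hall's condition holds for the neighbours of \<open>J\<close>, so there is an injection \<open>f\<close> from \<open>N(J)\<close> into
  \<open>J\<close> along edges (\<open>critical_matching\<close>). An independent set contains at most one end of each edge
  \<open>{y, f y}\<close>, so it meets \<open>L\<close> in at most \<open>|J|\<close> vertices, and since \<open>J\<close> can be added to any independent
  set outside \<open>L\<close>, independence numbers add up over \<open>L\<close> and its complement. Hence every \<open>S\<close> is a
  maximum independent set of \<open>G - L\<close> together with a set of \<open>|J|\<close> vertices in \<open>L\<close>, and outside \<open>L\<close> the
  core and the corona of \<open>G\<close> are those of \<open>G - L\<close>.

  Inside \<open>L\<close>, reaching \<open>|J|\<close> forces \<open>S\<close> to contain exactly one end of every edge \<open>{y, f y}\<close> and every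
  unmatched vertex of \<open>J\<close>. Thus \<open>y\<close> lies in the core iff \<open>f y\<close> is outside the corona, and \<open>y\<close> lies
  in the corona iff \<open>f y\<close> is outside the core; every matching edge and every unmatched vertex
  accounts for as much of \<open>|corona(G) \<inter> L| + |core(G) \<inter> L|\<close> as of \<open>2|J|\<close>
  (\<open>card_corona_core_in_larson\<close>). So \<open>|corona| + |core| - 2\<alpha>\<close> has the same value for \<open>G\<close> and
  for \<open>G - L\<close>, which is more than the theorem asks.

  It remains to know that Larson's set is \<open>J \<union> N(J)\<close>, that is, that this set has the four defining
  properties. The first two come from the matching, the third from the maximality of \<open>|J|\<close>, and the
  independence of the choice of \<open>J\<close> from the supermodularity of \<open>d\<close>
  (\<open>critical_subset_larson\<close>).
\<close>

section \<open>Hall's theorem\<close>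

text \<open>
  Rado's argument: as long as some \<open>N y\<close> contains two points, one of them can be deleted without
  violating Hall's condition; once all sets are singletons, the condition says that they are
  distinct.
\<close>

lemma hall_marriage:
  fixes N :: "'a \<Rightarrow> 'b set"
  assumes "finite Y" and "\<And>y. y \<in> Y \<Longrightarrow> finite (N y)"
    and "\<And>A. A \<subseteq> Y \<Longrightarrow> card A \<le> card (\<Union>(N ` A))"
  shows "\<exists>f. inj_on f Y \<and> (\<forall>y\<in>Y. f y \<in> N y)"
  using assms
proof (induction "\<Sum>y\<in>Y. card (N y)" arbitrary: N rule: less_induct)
  case less
  note fin = less.prems(2) and hall = less.prems(3)
  show ?case
  proof (cases "\<exists>y\<in>Y. \<exists>x1\<in>N y. \<exists>x2\<in>N y. x1 \<noteq> x2")
    case False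
    have "\<exists>x. N y = {x}" if "y \<in> Y" for y
    proof -
      have "N y \<noteq> {}" using hall[of "{y}"] that by auto
      with False that show ?thesis by blast
    qed
    then obtain f where f: "\<And>y. y \<in> Y \<Longrightarrow> N y = {f y}" by metis
    have "inj_on f Y"
    proof (rule inj_onI, rule ccontr)
      fix y z assume yz: "y \<in> Y" "z \<in> Y" "f y = f z" "y \<noteq> z"
      then show False using hall[of "{y, z}"] f[of y] f[of z] by simp
    qed
    with f show ?thesis by auto
  next
    case True
    then obtain y x1 x2 where y: "y \<in> Y" and x: "x1 \<in> N y" "x2 \<in> N y" "x1 \<noteq> x2" by blast
    define M where "M x = N(y := N y - {x})" for x
    have finM: "finite (M x z)" if "z \<in> Y" for x z using fin that by (auto simp: M_def)
    \<comment> \<open>Two violating families, one for each deletion, would both contain \<open>y\<close>; their union and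
      their intersection without \<open>y\<close> satisfy Hall's condition for \<open>N\<close>, and counting points leaves
      no room for both violations.\<close>
    have "\<exists>x\<in>{x1, x2}. \<forall>A\<subseteq>Y. card A \<le> card (\<Union>(M x ` A))"
    proof (rule ccontr)
      assume "\<not> ?thesis"
      then obtain A1 A2 where A1: "A1 \<subseteq> Y" "card (\<Union>(M x1 ` A1)) < card A1"
        and A2: "A2 \<subseteq> Y" "card (\<Union>(M x2 ` A2)) < card A2"
        by (auto simp: not_le)
      have y_in: "y \<in> A" if "A \<subseteq> Y" "card (\<Union>(M x ` A)) < card A" for A x
      proof (rule ccontr)
        assume "y \<notin> A"
        then have "M x ` A = N ` A" by (auto simp: M_def)
        with that hall[of A] show False by simp
      qed
      have y12: "y \<in> A1" "y \<in> A2" using y_in A1 A2 by auto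
      have finA: "finite A1" "finite A2" using A1 A2 less.prems(1) finite_subset by auto
      let ?U1 = "\<Union>(M x1 ` A1)" and ?U2 = "\<Union>(M x2 ` A2)"
      let ?B = "A1 \<inter> A2 - {y}"
      have finU: "finite ?U1" "finite ?U2" using finA finM A1(1) A2(1) by auto
      have un: "?U1 \<union> ?U2 = \<Union>(N ` (A1 \<union> A2))"
      proof
        show "\<Union>(N ` (A1 \<union> A2)) \<subseteq> ?U1 \<union> ?U2"
        proof
          fix v assume "v \<in> \<Union>(N ` (A1 \<union> A2))"
          then obtain z where z: "z \<in> A1 \<union> A2" "v \<in> N z" by auto
          show "v \<in> ?U1 \<union> ?U2"
          proof (cases "z = y")
            case True
            then have "v \<in> M x1 y \<or> v \<in> M x2 y" using z x(3) by (auto simp: M_def)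
            then show ?thesis using y12 by blast
          next
            case False
            then have "v \<in> M x1 z" "v \<in> M x2 z" using z by (auto simp: M_def)
            then show ?thesis using z by blast
          qed
        qed
      qed (auto simp: M_def split: if_splits)
      have "N z \<subseteq> ?U1 \<inter> ?U2" if "z \<in> ?B" for z
      proof -
        have "M x1 z = N z" "M x2 z = N z" using that by (auto simp: M_def)
        then show ?thesis using that by blast
      qed
      then have "card (\<Union>(N ` ?B)) \<le> card (?U1 \<inter> ?U2)"
        using finU by (intro card_mono) auto
      moreover have "card ?B \<le> card (\<Union>(N ` ?B))" using A1(1) by (intro hall) auto
      moreover have "card (A1 \<union> A2) \<le> card (?U1 \<union> ?U2)"
        unfolding un using A1(1) A2(1) by (intro hall) auto
      moreover have "card ?U1 + card ?U2 = card (?U1 \<union> ?U2) + card (?U1 \<inter> ?U2)"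
        using finU by (rule card_Un_Int)
      moreover have "card A1 + card A2 = card (A1 \<union> A2) + card (A1 \<inter> A2)"
        using finA by (rule card_Un_Int)
      moreover have "card (A1 \<inter> A2) = Suc (card ?B)"
        using finA y12 by (metis IntI card_Suc_Diff1 finite_Int)
      ultimately show False using A1(2) A2(2) by linarith
    qed
    then obtain x where x': "x \<in> N y" and hallM: "\<And>A. A \<subseteq> Y \<Longrightarrow> card A \<le> card (\<Union>(M x ` A))"
      using x by blast
    have "(\<Sum>z\<in>Y. card (M x z)) < (\<Sum>z\<in>Y. card (N z))"
    proof (rule sum_strict_mono_ex1)
      show "\<forall>z\<in>Y. card (M x z) \<le> card (N z)"
        using fin by (auto simp: M_def intro: card_mono)
      show "\<exists>z\<in>Y. card (M x z) < card (N z)"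
        using y card_Diff1_less[OF fin[OF y] x'] by (intro bexI[of _ y]) (simp_all add: M_def)
    qed (fact less.prems(1))
    then obtain f where "inj_on f Y" "\<forall>z\<in>Y. f z \<in> M x z"
      using less.hyps[of "M x"] less.prems(1) finM hallM by blast
    moreover have "M x z \<subseteq> N z" for z by (auto simp: M_def)
    ultimately show ?thesis by blast
  qed
qed

section \<open>Independent sets, matchings and induced subgraphs\<close>

lemma finite_independent_sets: "finite (verts H) \<Longrightarrow> finite {S. independent H S}"
  by (rule finite_subset[of _ "Pow (verts H)"]) (auto simp: independent_def)

lemma card_le_independence_number:
  "finite (verts H) \<Longrightarrow> independent H S \<Longrightarrow> card S \<le> independence_number H"
  unfolding independence_number_def by (intro Max_ge) (auto simp: finite_independent_sets)

lemma max_independent_sets_nonempty: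
  assumes "finite (verts H)"
  shows "max_independent_sets H \<noteq> {}"
proof -
  have "independent H {}" by (simp add: independent_def)
  then have "independence_number H \<in> card ` {S. independent H S}"
    unfolding independence_number_def
    using finite_independent_sets[OF assms] by (intro Max_in) auto
  then show ?thesis by (auto simp: max_independent_sets_def)
qed

lemma independence_number_eqI:
  assumes "finite (verts H)" "independent H S" "\<And>T. independent H T \<Longrightarrow> card T \<le> card S"
  shows "independence_number H = card S"
  unfolding independence_number_def
proof (rule Max_eqI)
  show "finite (card ` {T. independent H T})" using finite_independent_sets[OF assms(1)] by simp
  show "k \<le> card S" if "k \<in> card ` {T. independent H T}" for k using that assms(3) by auto
  show "card S \<in> card ` {T. independent H T}" using assms(2) by simp
qed

lemma corona_subset_verts: "corona H \<subseteq> verts H"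
  by (auto simp: corona_def max_independent_sets_def independent_def)

lemma core_subset_corona:
  assumes "finite (verts H)"
  shows "core H \<subseteq> corona H"
  using max_independent_sets_nonempty[OF assms] unfolding core_def corona_def by blast

text \<open>
  An independent set contains no edge, so each matching edge has an end outside it, and these ends
  are distinct.
\<close>

lemma card_matching_le:
  assumes "finite (verts H)" "wf_digraph H" "matching H M" "independent H S"
  shows "card M \<le> card (verts H) - card S"
proof -
  have "\<exists>v. v \<in> e \<and> v \<in> verts H - S" if e: "e \<in> M" for e
  proof -
    have "e \<in> edges H" using e assms(3) by (auto simp: matching_def)
    then obtain u v where uv: "e = {u, v}" "u \<rightarrow>\<^bsub>H\<^esub> v" by (auto simp: edges_def)
    then have "u \<in> verts H" "v \<in> verts H" using wf_digraph.adj_in_verts[OF assms(2)] by auto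
    moreover have "u \<notin> S \<or> v \<notin> S" using assms(4) uv(2) by (auto simp: independent_def)
    ultimately show ?thesis using uv(1) by auto
  qed
  then obtain g where g: "\<And>e. e \<in> M \<Longrightarrow> g e \<in> e \<and> g e \<in> verts H - S" by metis
  have "inj_on g M"
  proof (rule inj_onI, rule ccontr)
    fix e e' assume "e \<in> M" "e' \<in> M" "g e = g e'" "e \<noteq> e'"
    moreover from this have "disjnt e e'"
      using assms(3) by (auto simp: matching_def pairwise_def)
    ultimately show False using g unfolding disjnt_def by (metis disjoint_iff)
  qed
  then have "card M \<le> card (verts H - S)"
    using g assms(1) by (intro card_inj_on_le[of g]) auto
  moreover have "S \<subseteq> verts H" using assms(4) by (simp add: independent_def)
  ultimately show ?thesis using assms(1) by (simp add: card_Diff_subset finite_subset)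
qed

lemma koenig_egervaryI:
  assumes "finite (verts H)" "wf_digraph H" "matching H M" "independent H S"
    and card: "card S + card M = card (verts H)"
  shows "koenig_egervary H"
proof -
  have le: "card T + card N \<le> card (verts H)" if "matching H N" "independent H T" for N T
  proof -
    have "T \<subseteq> verts H" using that by (simp add: independent_def)
    then have "card T \<le> card (verts H)" using assms(1) by (rule card_mono[rotated])
    then show ?thesis using card_matching_le[OF assms(1,2) that] by linarith
  qed
  have "independence_number H = card S"
  proof (rule independence_number_eqI[OF assms(1,4)])
    show "card T \<le> card S" if "independent H T" for T using le[OF assms(3) that] card by linarith
  qed
  moreover have "matching_number H = card M"
    unfolding matching_number_def
  proof (intro Max_eqI)
    have "{N. matching H N} \<subseteq> Pow (Pow (verts H))"
      using wf_digraph.adj_in_verts[OF assms(2)] by (auto simp: matching_def edges_def)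
    then show "finite (card ` {N. matching H N})"
      using assms(1) by (meson finite_Pow_iff finite_imageI finite_subset)
    show "k \<le> card M" if "k \<in> card ` {N. matching H N}" for k
      using that le[OF _ assms(4)] card by force
    show "card M \<in> card ` {N. matching H N}" using assms(3) by auto
  qed
  ultimately show ?thesis using card by (simp add: koenig_egervary_def)
qed

lemma adj_induce_subgraph_iff:
  "u \<rightarrow>\<^bsub>G \<restriction> W\<^esub> v \<longleftrightarrow> u \<rightarrow>\<^bsub>G\<^esub> v \<and> u \<in> W \<and> v \<in> W"
  unfolding arcs_ends_conv induce_subgraph_def by auto

lemma independent_induce_subgraph_iff:
  "W \<subseteq> verts G \<Longrightarrow> independent (G \<restriction> W) S \<longleftrightarrow> independent G S \<and> S \<subseteq> W"
  unfolding independent_def adj_induce_subgraph_iff induce_subgraph_verts by blast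

lemma neighborhood_induce_subgraph:
  "X \<subseteq> W \<Longrightarrow> neighborhood (G \<restriction> W) X = neighborhood G X \<inter> W"
  unfolding neighborhood_def adj_induce_subgraph_iff by blast

lemma (in graph) graph_induce_subgraph:
  assumes "W \<subseteq> verts G"
  shows "graph (G \<restriction> W)"
proof -
  have ind: "induced_subgraph (G \<restriction> W) G" using assms by (rule induced_induce)
  interpret D: digraph "G \<restriction> W" using ind by (rule digraphI_induced)
  interpret S: sym_digraph "G \<restriction> W" using ind by (rule induced_graph_imp_graph)
  show ?thesis by unfold_locales
qed

section \<open>Critical independent sets\<close>

context graph
begin

lemma neighborhood_Un: "neighborhood G (X \<union> Y) = neighborhood G X \<union> neighborhood G Y"
  by (auto simp: neighborhood_def)

lemma neighborhood_mono: "X \<subseteq> Y \<Longrightarrow> neighborhood G X \<subseteq> neighborhood G Y"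
  by (auto simp: neighborhood_def)

lemma neighborhood_subset_verts: "neighborhood G X \<subseteq> verts G"
  by (auto simp: neighborhood_def adj_in_verts)

lemma finite_neighborhood [simp]: "finite (neighborhood G X)"
  using neighborhood_subset_verts finite_verts by (rule finite_subset)

lemma finite_independent: "independent G S \<Longrightarrow> finite S"
  unfolding independent_def using finite_verts finite_subset by blast

lemma independent_iff_disjoint_neighborhood:
  "independent G S \<longleftrightarrow> S \<subseteq> verts G \<and> S \<inter> neighborhood G S = {}"
  by (auto simp: independent_def neighborhood_def)

lemma independent_UnI:
  assumes "independent G S" "independent G T" "T \<inter> neighborhood G S = {}"
  shows "independent G (S \<union> T)"
proof -
  have "\<not> u \<rightarrow>\<^bsub>G\<^esub> v \<and> \<not> v \<rightarrow>\<^bsub>G\<^esub> u" if "u \<in> S" "v \<in> T" for u v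
    using that assms(3) graph_symmetric[of v u] by (auto simp: neighborhood_def)
  then show ?thesis using assms(1,2) by (auto simp: independent_def)
qed

lemma nbhd_difference_supermodular:
  assumes "finite X" "finite Y"
  shows "nbhd_difference G X + nbhd_difference G Y
    \<le> nbhd_difference G (X \<union> Y) + nbhd_difference G (X \<inter> Y)"
proof -
  have "card X + card Y = card (X \<union> Y) + card (X \<inter> Y)" using assms by (rule card_Un_Int)
  moreover have "card (neighborhood G X) + card (neighborhood G Y)
      = card (neighborhood G (X \<union> Y)) + card (neighborhood G X \<inter> neighborhood G Y)"
    unfolding neighborhood_Un by (rule card_Un_Int) simp_all
  moreover have "card (neighborhood G (X \<inter> Y)) \<le> card (neighborhood G X \<inter> neighborhood G Y)"
    by (rule card_mono) (simp_all add: neighborhood_mono)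
  ultimately show ?thesis unfolding nbhd_difference_def by linarith
qed

lemma max_critical_independent_exists: "\<exists>J. max_critical_independent G J"
proof -
  have fin: "finite {S. independent G S}" by (rule finite_independent_sets) simp
  have ne: "{S. independent G S} \<noteq> {}" by (auto simp: independent_def intro: exI[of _ "{}"])
  obtain X where X: "independent G X"
    "nbhd_difference G X = Max (nbhd_difference G ` {S. independent G S})"
    by (rule obtains_MAX[OF fin ne, of "nbhd_difference G"]) simp
  then have critX: "critical_independent G X"
    using fin by (simp add: critical_independent_def)
  have finC: "finite {X. critical_independent G X}"
    by (rule finite_subset[OF _ fin]) (auto simp: critical_independent_def)
  have neC: "{X. critical_independent G X} \<noteq> {}" using critX by auto
  obtain J where J: "critical_independent G J"
    "card J = Max (card ` {X. critical_independent G X})"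
    by (rule obtains_MAX[OF finC neC, of card]) simp
  then have "max_critical_independent G J"
    using finC by (simp add: max_critical_independent_def)
  then show ?thesis ..
qed

text \<open>
  If some set \<open>A\<close> of neighbours of \<open>J\<close> had fewer than \<open>|A|\<close> neighbours in \<open>J\<close>, deleting these from
  \<open>J\<close> would free all of \<open>A\<close> from the neighbourhood and increase the difference. So Hall's condition
  holds.
\<close>

lemma critical_matching:
  assumes "critical_independent G J"
  obtains f where "inj_on f (neighborhood G J)"
    and "\<And>y. y \<in> neighborhood G J \<Longrightarrow> f y \<in> J" and "\<And>y. y \<in> neighborhood G J \<Longrightarrow> y \<rightarrow>\<^bsub>G\<^esub> f y"
proof -
  have indJ: "independent G J" using assms by (simp add: critical_independent_def)
  have finJ: "finite J" using indJ by (rule finite_independent)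
  have "card A \<le> card (\<Union>y\<in>A. {x \<in> J. y \<rightarrow>\<^bsub>G\<^esub> x})" if A: "A \<subseteq> neighborhood G J" for A
  proof -
    let ?B = "\<Union>y\<in>A. {x \<in> J. y \<rightarrow>\<^bsub>G\<^esub> x}"
    have finA: "finite A" using A by (rule finite_subset) simp
    have B: "?B \<subseteq> J" by auto
    have "independent G (J - ?B)" using indJ by (auto simp: independent_def)
    then have "nbhd_difference G (J - ?B) \<le> nbhd_difference G J"
      using assms by (simp add: critical_independent_def)
    moreover have "neighborhood G (J - ?B) \<subseteq> neighborhood G J - A"
      using graph_symmetric by (auto simp: neighborhood_def)
    then have "card (neighborhood G (J - ?B)) \<le> card (neighborhood G J - A)"
      by (intro card_mono) auto
    moreover have "card (neighborhood G J - A) = card (neighborhood G J) - card A"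
      using finA A by (rule card_Diff_subset)
    moreover have "card A \<le> card (neighborhood G J)" using A by (intro card_mono) auto
    moreover have "card (J - ?B) = card J - card ?B"
      using B finJ by (intro card_Diff_subset) (auto intro: finite_subset)
    moreover have "card ?B \<le> card J" using finJ B by (rule card_mono)
    ultimately show ?thesis unfolding nbhd_difference_def by linarith
  qed
  then have "\<exists>f. inj_on f (neighborhood G J)
      \<and> (\<forall>y\<in>neighborhood G J. f y \<in> {x \<in> J. y \<rightarrow>\<^bsub>G\<^esub> x})"
    using finJ by (intro hall_marriage) auto
  then show ?thesis using that by auto
qed

end

section \<open>Larson's decomposition\<close>

locale max_critical_graph = graph G for G :: "('a, 'b) pre_digraph" +
  fixes J :: "'a set"
  assumes max_critical: "max_critical_independent G J"
begin

abbreviation larson :: "'a set" where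
  "larson \<equiv> J \<union> neighborhood G J"

abbreviation rest :: "('a, 'b) pre_digraph" where
  "rest \<equiv> G \<restriction> (verts G - larson)"

lemma critical_J: "critical_independent G J"
  using max_critical by (simp add: max_critical_independent_def)

lemma independent_J: "independent G J"
  using critical_J by (simp add: critical_independent_def)

lemma finite_J [simp]: "finite J"
  using independent_J by (rule finite_independent)

lemma J_disjoint_neighborhood: "J \<inter> neighborhood G J = {}"
  using independent_J by (simp add: independent_iff_disjoint_neighborhood)

lemma larson_subset_verts: "larson \<subseteq> verts G"
  using independent_J neighborhood_subset_verts by (auto simp: independent_def)

lemma critical_le_imp_card_le:
  assumes "independent G X" "nbhd_difference G J \<le> nbhd_difference G X"
  shows "card X \<le> card J"
proof -
  have "critical_independent G X"
    using assms critical_J unfolding critical_independent_def by (meson order_trans)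
  then show ?thesis using max_critical by (simp add: max_critical_independent_def)
qed

lemma critical_extension_trivial:
  assumes I: "independent G I" "I \<inter> larson = {}"
    and d: "nbhd_difference G J \<le> nbhd_difference G (J \<union> I)"
  shows "I = {}"
proof -
  have "card (J \<union> I) \<le> card J"
    using d independent_UnI[OF independent_J I(1)] I(2) by (intro critical_le_imp_card_le) auto
  moreover have "card (J \<union> I) = card J + card I"
    using I finite_independent[OF I(1)] by (intro card_Un_disjoint) auto
  ultimately show ?thesis using finite_independent[OF I(1)] by simp
qed

text \<open>
  Otherwise \<open>J \<union> I\<close> would be a larger critical independent set: the only new neighbours it has
  compared to \<open>J\<close> are those of \<open>I\<close> outside \<open>larson\<close>.
\<close>

lemma card_neighborhood_rest:
  assumes "I \<noteq> {}" "independent rest I"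
  shows "card I < card (neighborhood rest I)"
proof (rule ccontr)
  assume neg: "\<not> ?thesis"
  have ind: "independent G I" and sub: "I \<subseteq> verts G - larson"
    using assms(2) by (auto simp: independent_induce_subgraph_iff)
  have "neighborhood G (J \<union> I) \<subseteq> neighborhood G J \<union> neighborhood rest I"
  proof -
    have "x \<notin> J" if "x \<in> neighborhood G I" for x
      using that sub graph_symmetric by (auto simp: neighborhood_def)
    then show ?thesis
      using neighborhood_subset_verts[of I]
      by (auto simp: neighborhood_Un neighborhood_induce_subgraph[OF sub])
  qed
  then have "card (neighborhood G (J \<union> I)) \<le> card (neighborhood G J \<union> neighborhood rest I)"
    by (intro card_mono) (auto simp: neighborhood_induce_subgraph[OF sub])
  also have "\<dots> \<le> card (neighborhood G J) + card (neighborhood rest I)" by (rule card_Un_le)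
  finally have "card (neighborhood G (J \<union> I)) \<le> card (neighborhood G J) + card I"
    using neg by linarith
  moreover have "card (J \<union> I) = card J + card I"
    using sub finite_independent[OF ind] by (intro card_Un_disjoint) auto
  ultimately have "nbhd_difference G J \<le> nbhd_difference G (J \<union> I)"
    by (simp add: nbhd_difference_def)
  moreover have "I \<inter> larson = {}" using sub by auto
  ultimately have "I = {}" using critical_extension_trivial[OF ind] by simp
  with assms(1) show False by simp
qed

text \<open>
  By supermodularity \<open>J \<union> K\<close> has difference at least \<open>d(J)\<close>, but it need not be independent.
  Passing from \<open>J \<union> K\<close> to the independent set \<open>J \<union> (K - larson)\<close> loses the vertices of
  \<open>K \<inter> N(J)\<close>, while at least the neighbours \<open>J \<inter> N(K)\<close> disappear; the matching shows that the
  latter are at least as many. So the independent set has difference at least \<open>d(J)\<close>, and the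
  maximality of \<open>|J|\<close> gives \<open>K \<subseteq> larson\<close>. The same count then leaves \<open>J \<union> K\<close> no room for a
  neighbour outside \<open>larson\<close>.
\<close>

lemma critical_subset_larson:
  assumes K: "critical_independent G K"
  shows "K \<union> neighborhood G K \<subseteq> larson"
proof -
  let ?NJ = "neighborhood G J" and ?NK = "neighborhood G K"
  let ?d = "nbhd_difference G"
  have indK: "independent G K" using K by (simp add: critical_independent_def)
  have finK [simp]: "finite K" using indK by (rule finite_independent)
  have dJK: "?d J \<le> ?d (J \<union> K)"
  proof -
    have "independent G (J \<inter> K)" using indK by (auto simp: independent_def)
    then have "?d (J \<inter> K) \<le> ?d J" using critical_J by (simp add: critical_independent_def)
    moreover have "?d J \<le> ?d K"
      using K independent_J by (simp add: critical_independent_def)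
    ultimately show ?thesis using nbhd_difference_supermodular[of J K] by simp
  qed
  have swap: "card (K \<inter> ?NJ) \<le> card (J \<inter> ?NK)"
  proof -
    obtain f where f: "inj_on f ?NJ" "\<And>y. y \<in> ?NJ \<Longrightarrow> f y \<in> J"
      "\<And>y. y \<in> ?NJ \<Longrightarrow> y \<rightarrow>\<^bsub>G\<^esub> f y"
      using critical_matching[OF critical_J] by blast
    show ?thesis
    proof (rule card_inj_on_le[of f])
      show "inj_on f (K \<inter> ?NJ)" using f(1) by (rule inj_on_subset) auto
      show "f ` (K \<inter> ?NJ) \<subseteq> J \<inter> ?NK" using f(2,3) by (auto simp: neighborhood_def)
    qed simp
  qed
  have K_sub: "K \<subseteq> larson"
  proof -
    let ?I = "K - larson"
    have indI: "independent G ?I" using indK by (auto simp: independent_def)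
    have "card (J \<union> K) = card (J \<union> ?I) + card (K \<inter> ?NJ)"
      using J_disjoint_neighborhood
      by (subst card_Un_disjoint[symmetric]) (auto intro!: arg_cong[of _ _ card])
    moreover have "card (neighborhood G (J \<union> ?I)) + card (J \<inter> ?NK) \<le> card (neighborhood G (J \<union> K))"
    proof -
      have disj: "neighborhood G (J \<union> ?I) \<inter> (J \<inter> ?NK) = {}"
      proof -
        have "independent G (J \<union> ?I)"
          using independent_J indI by (rule independent_UnI) auto
        then show ?thesis by (auto simp: independent_iff_disjoint_neighborhood)
      qed
      have "neighborhood G (J \<union> ?I) \<union> (J \<inter> ?NK) \<subseteq> neighborhood G (J \<union> K)"
        using neighborhood_mono[of "J \<union> ?I" "J \<union> K"] by (auto simp: neighborhood_Un)
      then have "card (neighborhood G (J \<union> ?I) \<union> (J \<inter> ?NK)) \<le> card (neighborhood G (J \<union> K))"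
        by (intro card_mono) auto
      then show ?thesis using disj by (subst card_Un_disjoint[symmetric]) auto
    qed
    ultimately have "?d J \<le> ?d (J \<union> ?I)"
      using dJK swap unfolding nbhd_difference_def by linarith
    then have "?I = {}" using critical_extension_trivial[OF indI] by auto
    then show ?thesis by auto
  qed
  have "?NK - larson = {}"
  proof -
    have "J \<union> K = J \<union> (K \<inter> ?NJ)" using K_sub by auto
    then have "card (J \<union> K) = card J + card (K \<inter> ?NJ)"
      using J_disjoint_neighborhood by (subst card_Un_disjoint[symmetric]) auto
    moreover have "card (neighborhood G (J \<union> K)) = card ?NJ + card (J \<inter> ?NK) + card (?NK - larson)"
    proof -
      have "neighborhood G (J \<union> K) = ?NJ \<union> (J \<inter> ?NK) \<union> (?NK - larson)"
        by (auto simp: neighborhood_Un)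
      moreover have "card (?NJ \<union> (J \<inter> ?NK) \<union> (?NK - larson))
          = card (?NJ \<union> (J \<inter> ?NK)) + card (?NK - larson)"
        by (rule card_Un_disjoint) auto
      moreover have "card (?NJ \<union> (J \<inter> ?NK)) = card ?NJ + card (J \<inter> ?NK)"
        using J_disjoint_neighborhood by (intro card_Un_disjoint) auto
      ultimately show ?thesis by simp
    qed
    ultimately have "card (?NK - larson) = 0"
      using dJK swap unfolding nbhd_difference_def by linarith
    then show ?thesis by simp
  qed
  with K_sub show ?thesis by auto
qed

definition mate :: "'a \<Rightarrow> 'a" where
  "mate = (SOME f. inj_on f (neighborhood G J)
     \<and> (\<forall>y\<in>neighborhood G J. f y \<in> J \<and> y \<rightarrow>\<^bsub>G\<^esub> f y))"

lemma mate_props: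
  "inj_on mate (neighborhood G J)
   \<and> (\<forall>y\<in>neighborhood G J. mate y \<in> J \<and> y \<rightarrow>\<^bsub>G\<^esub> mate y)"
proof -
  have "\<exists>f. inj_on f (neighborhood G J)
      \<and> (\<forall>y\<in>neighborhood G J. f y \<in> J \<and> y \<rightarrow>\<^bsub>G\<^esub> f y)"
    using critical_matching[OF critical_J] by metis
  then show ?thesis unfolding mate_def by (rule someI_ex)
qed

lemmas inj_on_mate = conjunct1[OF mate_props]

lemma mate_in: "y \<in> neighborhood G J \<Longrightarrow> mate y \<in> J"
  and adj_mate: "y \<in> neighborhood G J \<Longrightarrow> y \<rightarrow>\<^bsub>G\<^esub> mate y"
  using mate_props by auto

text \<open>
  Projecting every vertex of \<open>larson\<close> to the end in \<open>J\<close> of its matching edge is injective on an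
  independent set; its range being \<open>J\<close> is what makes the sets of size \<open>|J|\<close> rigid.
\<close>

definition to_J :: "'a \<Rightarrow> 'a" where
  "to_J v = (if v \<in> J then v else mate v)"

lemma to_J_image: "A \<subseteq> larson \<Longrightarrow> to_J ` A \<subseteq> J"
  using mate_in by (auto simp: to_J_def)

lemma inj_on_to_J:
  assumes "independent G A" "A \<subseteq> larson"
  shows "inj_on to_J A"
proof (rule inj_onI)
  fix v w assume vw: "v \<in> A" "w \<in> A" "to_J v = to_J w"
  have adj: "\<not> v \<rightarrow>\<^bsub>G\<^esub> w" "\<not> w \<rightarrow>\<^bsub>G\<^esub> v" using assms(1) vw by (auto simp: independent_def)
  show "v = w"
  proof (cases "v \<in> J \<or> w \<in> J")
    case True
    then show ?thesis
      using vw assms(2) adj adj_mate[of v] adj_mate[of w] by (auto simp: to_J_def split: if_splits)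
  next
    case False
    then have "v \<in> neighborhood G J" "w \<in> neighborhood G J" "mate v = mate w"
      using vw assms(2) by (auto simp: to_J_def)
    then show ?thesis using inj_on_mate by (meson inj_onD)
  qed
qed

lemma card_independent_in_larson:
  "independent G A \<Longrightarrow> A \<subseteq> larson \<Longrightarrow> card A \<le> card J"
  using card_inj_on_le[OF inj_on_to_J to_J_image finite_J] .

lemma independence_number_larson: "independence_number (G \<restriction> larson) = card J"
proof (rule independence_number_eqI)
  show "finite (verts (G \<restriction> larson))" by simp
  show "independent (G \<restriction> larson) J"
    using independent_J larson_subset_verts by (simp add: independent_induce_subgraph_iff)
  show "card T \<le> card J" if "independent (G \<restriction> larson) T" for T
    using that larson_subset_verts card_independent_in_larson
    by (simp add: independent_induce_subgraph_iff)
qed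

lemma koenig_egervary_larson: "koenig_egervary (G \<restriction> larson)"
proof (rule koenig_egervaryI)
  let ?NJ = "neighborhood G J"
  let ?M = "(\<lambda>y. {y, mate y}) ` ?NJ"
  show "finite (verts (G \<restriction> larson))" by simp
  show "wf_digraph (G \<restriction> larson)" by (rule wellformed_induce_subgraph)
  show "independent (G \<restriction> larson) J"
    using independent_J larson_subset_verts by (simp add: independent_induce_subgraph_iff)
  have disj: "{y, mate y} \<inter> {z, mate z} = {}" if "y \<in> ?NJ" "z \<in> ?NJ" "y \<noteq> z" for y z
    using that mate_in J_disjoint_neighborhood inj_onD[OF inj_on_mate] by auto
  have "?M \<subseteq> edges (G \<restriction> larson)"
    using adj_mate mate_in by (auto simp: edges_def adj_induce_subgraph_iff)
  moreover have "pairwise disjnt ?M"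
    unfolding pairwise_image by (rule pairwiseI) (metis disj disjnt_def)
  ultimately show "matching (G \<restriction> larson) ?M" by (simp add: matching_def)
  have "inj_on (\<lambda>y. {y, mate y}) ?NJ"
    using disj by (intro inj_onI) blast
  then have "card ?M = card ?NJ" by (rule card_image)
  then show "card J + card ?M = card (verts (G \<restriction> larson))"
    using J_disjoint_neighborhood by (simp add: card_Un_disjoint)
qed

lemma independent_Un_rest:
  assumes "independent rest S"
  shows "independent G (J \<union> S)" "card (J \<union> S) = card J + card S"
proof -
  have S: "independent G S" "S \<subseteq> verts G - larson"
    using assms by (auto simp: independent_induce_subgraph_iff)
  show "independent G (J \<union> S)" using independent_J S by (intro independent_UnI) auto
  show "card (J \<union> S) = card J + card S"
    using S finite_independent by (intro card_Un_disjoint) auto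
qed

lemma card_independent_split:
  assumes "independent G S"
  shows "card S = card (S \<inter> larson) + card (S - larson)"
    and "card (S \<inter> larson) \<le> card J" and "card (S - larson) \<le> independence_number rest"
    and "independent rest (S - larson)"
proof -
  show "card S = card (S \<inter> larson) + card (S - larson)"
    using finite_independent[OF assms] by (subst card_Un_disjoint[symmetric]) (auto simp: Int_Diff_Un)
  have "independent G (S \<inter> larson)" using assms by (auto simp: independent_def)
  then show "card (S \<inter> larson) \<le> card J" by (rule card_independent_in_larson) auto
  show ind: "independent rest (S - larson)"
    using assms unfolding independent_def adj_induce_subgraph_iff by auto
  then show "card (S - larson) \<le> independence_number rest"
    by (intro card_le_independence_number) auto
qed

lemma independence_number_split: "independence_number G = card J + independence_number rest"
proof -
  obtain S where S: "independent rest S" "card S = independence_number rest"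
    using max_independent_sets_nonempty[of rest] by (auto simp: max_independent_sets_def)
  have "independence_number G = card (J \<union> S)"
  proof (rule independence_number_eqI)
    fix T assume "independent G T"
    then show "card T \<le> card (J \<union> S)"
      using card_independent_split[of T] independent_Un_rest(2)[OF S(1)] S(2) by linarith
  qed (use independent_Un_rest[OF S(1)] in auto)
  then show ?thesis using independent_Un_rest(2)[OF S(1)] S(2) by simp
qed

end

text \<open>
  Two maximum critical independent sets yield the same set, because each of the two resulting sets
  contains the other.
\<close>

lemma (in max_critical_graph) is_larson_set_larson: "is_larson_set G larson"
proof -
  have "larson = K \<union> neighborhood G K" if "max_critical_independent G K" for K
  proof
    interpret K: max_critical_graph G K using that by unfold_locales
    show "larson \<subseteq> K \<union> neighborhood G K" using K.critical_subset_larson critical_J .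
    show "K \<union> neighborhood G K \<subseteq> larson" using critical_subset_larson K.critical_J .
  qed
  moreover have "independence_number G = independence_number (G \<restriction> larson) + independence_number rest"
    unfolding independence_number_larson by (rule independence_number_split)
  ultimately show ?thesis
    unfolding is_larson_set_def
    using larson_subset_verts koenig_egervary_larson card_neighborhood_rest by blast
qed

lemma (in max_critical_graph) larson_set_eq: "larson_set G = larson"
  unfolding larson_set_def
proof (rule the_equality)
  show "is_larson_set G larson" by (rule is_larson_set_larson)
  show "L = larson" if "is_larson_set G L" for L
    using that max_critical by (simp add: is_larson_set_def)
qed

section \<open>Core and corona along the decomposition\<close>

context max_critical_graph
begin

lemma max_independent_split:
  assumes "S \<in> max_independent_sets G"
  shows "card (S \<inter> larson) = card J" and "S - larson \<in> max_independent_sets rest"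
proof -
  have S: "independent G S" "card S = independence_number G"
    using assms by (simp_all add: max_independent_sets_def)
  note split = card_independent_split[OF S(1)]
  show "card (S \<inter> larson) = card J"
    using split(1-3) S(2) independence_number_split by linarith
  have "card (S - larson) = independence_number rest"
    using split(1-3) S(2) independence_number_split by linarith
  with split(4) show "S - larson \<in> max_independent_sets rest"
    by (simp add: max_independent_sets_def)
qed

lemma max_independent_Un_rest:
  "S \<in> max_independent_sets rest \<Longrightarrow> J \<union> S \<in> max_independent_sets G"
  by (simp add: max_independent_sets_def independent_Un_rest independence_number_split)

lemma corona_outside_larson: "corona G - larson = corona rest"
proof
  show "corona G - larson \<subseteq> corona rest"
    unfolding corona_def using max_independent_split(2) by blast
  show "corona rest \<subseteq> corona G - larson"
  proof
    fix x assume x: "x \<in> corona rest"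
    then have "x \<in> verts G - larson" using corona_subset_verts[of rest] by auto
    moreover have "x \<in> corona G" using x max_independent_Un_rest unfolding corona_def by blast
    ultimately show "x \<in> corona G - larson" by simp
  qed
qed

lemma core_outside_larson: "core G - larson = core rest"
proof
  show "core G - larson \<subseteq> core rest"
    unfolding core_def using max_independent_Un_rest by blast
  have "core rest \<subseteq> verts G - larson"
    using core_subset_corona[of rest] corona_subset_verts[of rest] by auto
  then show "core rest \<subseteq> core G - larson"
    unfolding core_def using max_independent_split(2) by blast
qed

text \<open>
  With \<open>|J|\<close> vertices in \<open>larson\<close>, the injective projection to \<open>J\<close> is onto.
\<close>

lemma max_independent_to_J:
  assumes "S \<in> max_independent_sets G"
  shows "to_J ` (S \<inter> larson) = J"
proof (rule card_subset_eq)
  have "independent G (S \<inter> larson)"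
    using assms by (auto simp: max_independent_sets_def independent_def)
  then have "inj_on to_J (S \<inter> larson)" by (rule inj_on_to_J) auto
  then show "card (to_J ` (S \<inter> larson)) = card J"
    using max_independent_split(1)[OF assms] by (simp add: card_image)
qed (use to_J_image[of "S \<inter> larson"] in auto)

lemma max_independent_mate_iff:
  assumes S: "S \<in> max_independent_sets G" and y: "y \<in> neighborhood G J"
  shows "y \<in> S \<longleftrightarrow> mate y \<notin> S"
proof
  show "mate y \<notin> S" if "y \<in> S"
    using that S adj_mate[OF y] by (auto simp: max_independent_sets_def independent_def)
  assume neg: "mate y \<notin> S"
  obtain v where v: "v \<in> S" "v \<in> larson" "to_J v = mate y"
  proof -
    have "mate y \<in> to_J ` (S \<inter> larson)"
      unfolding max_independent_to_J[OF S] using y by (rule mate_in)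
    then show ?thesis using that by auto
  qed
  then have "v \<in> neighborhood G J" "mate v = mate y"
    using neg by (auto simp: to_J_def split: if_splits)
  then show "y \<in> S" using v(1) y inj_onD[OF inj_on_mate, of v y] by simp
qed

lemma max_independent_unmatched:
  assumes S: "S \<in> max_independent_sets G" and x: "x \<in> J" "x \<notin> mate ` neighborhood G J"
  shows "x \<in> S"
proof -
  obtain v where v: "v \<in> S" "v \<in> larson" "to_J v = x"
  proof -
    have "x \<in> to_J ` (S \<inter> larson)" unfolding max_independent_to_J[OF S] by (rule x(1))
    then show ?thesis using that by auto
  qed
  then show ?thesis using x(2) by (auto simp: to_J_def split: if_splits)
qed

text \<open>
  The matching exchanges the two sets up to complement: it maps \<open>core(G) \<inter> N(J)\<close> onto
  \<open>J - corona(G)\<close> and \<open>corona(G) \<inter> N(J)\<close> onto \<open>J - core(G)\<close>. Unmatched vertices of \<open>J\<close> lie in the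
  core, so they belong to neither of the two differences.
\<close>

lemma card_corona_core_in_larson:
  "card (corona G \<inter> larson) + card (core G \<inter> larson) = 2 * card J"
proof -
  let ?NJ = "neighborhood G J"
  obtain S0 where S0: "S0 \<in> max_independent_sets G"
    using max_independent_sets_nonempty[of G] by auto
  have un: "x \<in> core G \<and> x \<in> corona G" if "x \<in> J" "x \<notin> mate ` ?NJ" for x
    using max_independent_unmatched[OF _ that] S0 by (auto simp: core_def corona_def)
  have image: "mate ` (X \<inter> ?NJ) = J - Y"
    if iff: "\<And>y. y \<in> ?NJ \<Longrightarrow> y \<in> X \<longleftrightarrow> mate y \<notin> Y"
      and sub: "\<And>x. x \<in> J \<Longrightarrow> x \<notin> mate ` ?NJ \<Longrightarrow> x \<in> Y" for X Y
  proof
    show "mate ` (X \<inter> ?NJ) \<subseteq> J - Y" using iff mate_in by auto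
    show "J - Y \<subseteq> mate ` (X \<inter> ?NJ)"
    proof
      fix x assume x: "x \<in> J - Y"
      then obtain y where "y \<in> ?NJ" "x = mate y" using sub by blast
      then show "x \<in> mate ` (X \<inter> ?NJ)" using iff x by auto
    qed
  qed
  have "y \<in> core G \<longleftrightarrow> mate y \<notin> corona G" "y \<in> corona G \<longleftrightarrow> mate y \<notin> core G"
    if "y \<in> ?NJ" for y
    using max_independent_mate_iff[OF _ that] unfolding core_def corona_def by blast+
  then have "mate ` (core G \<inter> ?NJ) = J - corona G" "mate ` (corona G \<inter> ?NJ) = J - core G"
    using un by (intro image; blast)+
  moreover have "card (mate ` (X \<inter> ?NJ)) = card (X \<inter> ?NJ)" for X
    using inj_on_mate by (intro card_image) (auto intro: inj_on_subset)
  ultimately have flip: "card (core G \<inter> ?NJ) = card (J - corona G)"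
    "card (corona G \<inter> ?NJ) = card (J - core G)" by metis+
  have split: "card (X \<inter> larson) = card (X \<inter> J) + card (X \<inter> ?NJ)" for X
    unfolding Int_Un_distrib using J_disjoint_neighborhood by (intro card_Un_disjoint) auto
  have "card J = card (X \<inter> J) + card (J - X)" for X
    by (subst card_Un_disjoint[symmetric]) (auto intro!: arg_cong[of _ _ card])
  from this[of "core G"] this[of "corona G"] show ?thesis
    unfolding split flip by linarith
qed

lemma corona_core_balance:
  "card (corona G) + card (core G) = 2 * card J + (card (corona rest) + card (core rest))"
proof -
  have fin: "finite (corona G)" "finite (core G)"
    using corona_subset_verts[of G] core_subset_corona[of G] finite_verts
    by (meson finite_subset)+
  have "card X = card (X \<inter> larson) + card (X - larson)" if "finite X" for X
    using that by (subst card_Un_disjoint[symmetric]) (auto simp: Int_Diff_Un)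
  from this[OF fin(1)] this[OF fin(2)] show ?thesis
    using card_corona_core_in_larson corona_outside_larson core_outside_larson by simp
qed

end

theorem theorem3p9:
  fixes G :: "('a, 'b) pre_digraph"
  assumes "graph G"
  shows "G \<in> corona_core_family \<longleftrightarrow> larson_complement G \<in> corona_core_family"
proof -
  interpret graph G by fact
  obtain J where "max_critical_independent G J" using max_critical_independent_exists by blast
  then interpret max_critical_graph G J by unfold_locales
  have "graph rest" by (rule graph_induce_subgraph) auto
  then show ?thesis
    using assms
    unfolding corona_core_family_def larson_complement_def larson_set_eq mem_Collect_eq
      corona_core_balance independence_number_split
    by simp
qed

end
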